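(* Let $A,B$ be $n\times n$ complex positive definite matrices and let $G(A,B)=A\#B$ denote the geometric mean map. Then for all $n\times n$ complex Hermitian matrices $X,Y$, the derivative $\mathrm{D}G(A,B)(X,Y)=\left.\frac{d}{dt}\right|_{t=0}G(A+tX,B+tY)$ is given by $$\mathrm{D}G(A,B)(X,Y)=\int_0^{\infty} e^{-t (BA^{-1})^{1/2}}\left(Y+(BA^{-1})^{1/2} X (A^{-1} B)^{1/2}\right) e^{-t(A^{-1} B)^{1/2}}\, dt.$$
   Context: $\mathbb P(n,\mathbb C)$ is the set of $n\times n$ complex positive definite (Hermitian) matrices. For $A,B\in\mathbb P(n,\mathbb C)$ the geometric mean is $A\#B=A^{1/2}(A^{-1/2}BA^{-1/2})^{1/2}A^{1/2}$, and $G:\mathbb P(n,\mathbb C)\times\mathbb P(n,\mathbb C)\to\mathbb P(n,\mathbb C)$, $G(A,B)=A\#B$, which is differentiable. The matrices $A^{-1}B$ and $BA^{-1}$ have positive eigenvalues; $(A^{-1}B)^{1/2}$ and $(BA^{-1})^{1/2}$ denote their unique square roots having positive eigenvalues. *)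

theory Defs
  imports "HOL-Analysis.Analysis"
begin

definition conj_transpose :: "complex^'n^'m \<Rightarrow> complex^'m^'n" where
  "conj_transpose A = (\<chi> i j. cnj (A $ j $ i))"

definition hermitian :: "complex^'n^'n \<Rightarrow> bool" where
  "hermitian A \<longleftrightarrow> conj_transpose A = A"

text \<open>For Hermitian \<open>A\<close> the quadratic form \<open>x\<^sup>* A x\<close> is real, so \<open>Re\<close> loses nothing.\<close>

definition pos_def :: "complex^'n^'n \<Rightarrow> bool" where
  "pos_def A \<longleftrightarrow> hermitian A \<and>
     (\<forall>x. x \<noteq> 0 \<longrightarrow> 0 < Re (\<Sum>i\<in>UNIV. cnj (x $ i) * (A *v x) $ i))"

definition eigval :: "complex^'n^'n \<Rightarrow> complex \<Rightarrow> bool" where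
  "eigval A c \<longleftrightarrow> (\<exists>v. v \<noteq> 0 \<and> A *v v = c *s v)"

definition pos_eigvals :: "complex^'n^'n \<Rightarrow> bool" where
  "pos_eigvals A \<longleftrightarrow> (\<forall>c. eigval A c \<longrightarrow> (\<exists>r::real. 0 < r \<and> c = of_real r))"

text \<open>Two square roots are used: \<open>pd_sqrt A\<close> is the positive definite square root of a positive
  definite matrix, while \<open>pe_sqrt M\<close> is the square root with positive eigenvalues of a matrix \<open>M\<close>
  with positive eigenvalues, which need not be Hermitian (such as \<open>A\<^sup>-\<^sup>1 B\<close>).\<close>

definition pd_sqrt :: "complex^'n^'n \<Rightarrow> complex^'n^'n" where
  "pd_sqrt A = (THE S. pos_def S \<and> S ** S = A)"

definition pe_sqrt :: "complex^'n^'n \<Rightarrow> complex^'n^'n" where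
  "pe_sqrt M = (THE S. pos_eigvals S \<and> S ** S = M)"

definition geom_mean :: "complex^'n^'n \<Rightarrow> complex^'n^'n \<Rightarrow> complex^'n^'n" where
  "geom_mean A B =
     pd_sqrt A ** pd_sqrt (matrix_inv (pd_sqrt A) ** B ** matrix_inv (pd_sqrt A)) ** pd_sqrt A"

text \<open>The multiplication \<open>*\<close> of the vector type is componentwise, so the library's \<open>^\<close> and \<open>exp\<close>
  do not give matrix powers and the matrix exponential.\<close>

primrec mat_pow :: "complex^'n^'n \<Rightarrow> nat \<Rightarrow> complex^'n^'n" where
  "mat_pow A 0 = mat 1"
| "mat_pow A (Suc k) = A ** mat_pow A k"

definition mat_exp :: "complex^'n^'n \<Rightarrow> complex^'n^'n" where
  "mat_exp A = (\<Sum>k. (1 / fact k) *\<^sub>R mat_pow A k)"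

definition geom_mean_integrand ::
  "complex^'n^'n \<Rightarrow> complex^'n^'n \<Rightarrow> complex^'n^'n \<Rightarrow> complex^'n^'n \<Rightarrow> real \<Rightarrow> complex^'n^'n" where
  "geom_mean_integrand A B X Y t =
     mat_exp ((- t) *\<^sub>R pe_sqrt (B ** matrix_inv A)) **
     (Y + pe_sqrt (B ** matrix_inv A) ** X ** pe_sqrt (matrix_inv A ** B)) **
     mat_exp ((- t) *\<^sub>R pe_sqrt (matrix_inv A ** B))"

end

theory Submission
  imports Defs
begin

text \<open>Let \<open>M = A\<^sup>1\<^sup>/\<^sup>2\<close>, \<open>R = M\<^sup>-\<^sup>1\<close>, \<open>K = (R B R)\<^sup>1\<^sup>/\<^sup>2\<close> and \<open>G = M K M\<close>. Then \<open>P = M K R = G A\<^sup>-\<^sup>1\<close> and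
  \<open>Q = R K M = A\<^sup>-\<^sup>1 G\<close> are the square roots of \<open>B A\<^sup>-\<^sup>1\<close> and \<open>A\<^sup>-\<^sup>1 B\<close>. Differentiating
  \<open>G A\<^sup>-\<^sup>1 G = B\<close> shows that the derivative \<open>Z\<close> satisfies \<open>P Z + Z Q = Y + P X Q\<close>. The integral solves this
  equation: conjugation by \<open>R\<close> turns its integrand into a solution of \<open>f' = -(K f + f K)\<close>, which decays
  exponentially as \<open>K\<close> is positive definite.\<close>

section \<open>Hermitian matrices and the real inner product\<close>

text \<open>Differentiating the equation for \<open>G\<close> presupposes that \<open>G\<close> is
  differentiable, which is not visible from its definition by square roots and has to be proved.
  This, the uniqueness of the root and the decay of the integrand all rest on one device, which
  replaces diagonalisation. In the Frobenius inner product, the real part of the trace of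
  \<open>conj_transpose X ** Y\<close>, multiplication by a positive definite matrix from either
  side is coercive, and so is a sum such as \<open>S ** D + D ** T\<close> as a function of
  \<open>D\<close>. The obstacle is that \<open>P\<close> and \<open>Q\<close> are not Hermitian and
  need not be coercive, so each estimate is first moved to Hermitian coefficients by multiplying
  with \<open>R\<close>.\<close>

lemma bounded_bilinear_matrix_mult:
  "bounded_bilinear ((**) :: complex^'m^'n \<Rightarrow> complex^'p^'m \<Rightarrow> complex^'p^'n)"
proof -
  have "bilinear ((**) :: complex^'m^'n \<Rightarrow> complex^'p^'m \<Rightarrow> complex^'p^'n)"
    unfolding bilinear_def
    by (auto intro!: linearI simp: matrix_matrix_mult_def vec_eq_iff sum.distrib algebra_simps scaleR_sum_right)
  then show ?thesis
    by (simp add: bilinear_conv_bounded_bilinear)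
qed

interpretation matrix_mul: bounded_bilinear
  "(**) :: complex^'m^'n \<Rightarrow> complex^'p^'m \<Rightarrow> complex^'p^'n"
  by (rule bounded_bilinear_matrix_mult)

lemma conj_transpose_nth [simp]: "conj_transpose A $ i $ j = cnj (A $ j $ i)"
  by (simp add: conj_transpose_def)

lemma conj_transpose_conj_transpose [simp]: "conj_transpose (conj_transpose A) = A"
  by (simp add: vec_eq_iff)

lemma conj_transpose_mul: "conj_transpose (A ** B) = conj_transpose B ** conj_transpose A"
  by (simp add: vec_eq_iff matrix_matrix_mult_def mult.commute)

lemma conj_transpose_add: "conj_transpose (A + B) = conj_transpose A + conj_transpose B"
  and conj_transpose_diff: "conj_transpose (A - B) = conj_transpose A - conj_transpose B"
  and conj_transpose_scaleR: "conj_transpose (r *\<^sub>R A) = r *\<^sub>R conj_transpose A"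
  by (simp_all add: vec_eq_iff)

lemma conj_transpose_mat_1 [simp]: "conj_transpose (mat 1) = mat 1"
  by (auto simp: vec_eq_iff mat_def)

lemma hermitian_add: "hermitian A \<Longrightarrow> hermitian B \<Longrightarrow> hermitian (A + B)"
  and hermitian_diff: "hermitian A \<Longrightarrow> hermitian B \<Longrightarrow> hermitian (A - B)"
  and hermitian_scaleR: "hermitian A \<Longrightarrow> hermitian (r *\<^sub>R A)"
  and hermitian_mat_1: "hermitian (mat 1)"
  by (simp_all add: hermitian_def conj_transpose_add conj_transpose_diff conj_transpose_scaleR)

lemma hermitian_square: "hermitian A \<Longrightarrow> hermitian (A ** A)"
  by (simp add: hermitian_def conj_transpose_mul)

lemma hermitian_congruence:
  "hermitian A \<Longrightarrow> hermitian (conj_transpose M ** A ** M)"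
  by (simp add: hermitian_def conj_transpose_mul matrix_mul_assoc)

lemma hermitian_inverse:
  assumes "hermitian A" "A ** B = mat 1"
  shows "hermitian B"
proof -
  have "conj_transpose B ** A = mat 1"
    using arg_cong[OF assms(2), of conj_transpose] assms(1)
    by (simp add: conj_transpose_mul hermitian_def)
  then have "conj_transpose B = B"
    by (metis assms(2) matrix_mul_assoc matrix_mul_lid matrix_mul_rid)
  then show ?thesis by (simp add: hermitian_def)
qed

text \<open>The inner product on \<open>complex\<close> is the real one,
  \<open>Re (cnj a * b)\<close>. The adjoint of multiplication by \<open>a\<close> is still
  multiplication by \<open>cnj a\<close>, which makes \<open>conj_transpose\<close> the adjoint for
  vectors and matrices.\<close>

lemma inner_mult_complex: "(a * b) \<bullet> c = b \<bullet> (cnj a * c)" for a b c :: complex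
  by (simp add: inner_complex_def algebra_simps)

lemma scaleR_matrix_vector:
  fixes A :: "complex^'n^'m"
  shows "(r *\<^sub>R A) *v x = r *\<^sub>R (A *v x)"
  by (simp add: vec_eq_iff matrix_vector_mult_def scaleR_sum_right)

lemma matrix_vector_scaleR:
  fixes A :: "complex^'n^'m"
  shows "A *v (r *\<^sub>R x) = r *\<^sub>R (A *v x)"
  by (simp add: vec_eq_iff matrix_vector_mult_def scaleR_sum_right)

lemma inner_matrix_vector:
  fixes M :: "complex^'n^'m"
  shows "(M *v x) \<bullet> y = x \<bullet> (conj_transpose M *v y)"
proof -
  have "(M *v x) \<bullet> y = (\<Sum>i\<in>UNIV. \<Sum>k\<in>UNIV. x $ k \<bullet> (cnj (M $ i $ k) * y $ i))"
    by (simp add: inner_vec_def matrix_vector_mult_def inner_sum_left inner_mult_complex)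
  also have "\<dots> = (\<Sum>k\<in>UNIV. \<Sum>i\<in>UNIV. x $ k \<bullet> (cnj (M $ i $ k) * y $ i))"
    by (rule sum.swap)
  also have "\<dots> = x \<bullet> (conj_transpose M *v y)"
    by (simp add: inner_vec_def matrix_vector_mult_def inner_sum_right)
  finally show ?thesis .
qed

lemma hermitian_inner: "hermitian K \<Longrightarrow> (K *v x) \<bullet> y = x \<bullet> (K *v y)"
  by (simp add: inner_matrix_vector hermitian_def)

text \<open>Left multiplication acts on each column separately, so estimates for vectors pass to
  matrices by summation over the columns.\<close>

lemma inner_matrix_columns:
  fixes X Y :: "complex^'n^'m"
  shows "X \<bullet> Y = (\<Sum>j\<in>UNIV. column j X \<bullet> column j Y)"
proof -
  have "X \<bullet> Y = (\<Sum>i\<in>UNIV. \<Sum>j\<in>UNIV. X $ i $ j \<bullet> Y $ i $ j)"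
    by (simp add: inner_vec_def)
  also have "\<dots> = (\<Sum>j\<in>UNIV. \<Sum>i\<in>UNIV. X $ i $ j \<bullet> Y $ i $ j)"
    by (rule sum.swap)
  finally show ?thesis by (simp add: inner_vec_def column_def)
qed

lemma column_matrix_mult: "column j (A ** B) = A *v column j B"
  by (simp add: vec_eq_iff column_def matrix_matrix_mult_def matrix_vector_mult_def)

lemma inner_mult_left:
  fixes M :: "complex^'n^'m" and X :: "complex^'p^'n"
  shows "(M ** X) \<bullet> Y = X \<bullet> (conj_transpose M ** Y)"
  by (simp add: inner_matrix_columns column_matrix_mult inner_matrix_vector)

lemma inner_conj_transpose [simp]: "conj_transpose X \<bullet> conj_transpose Y = X \<bullet> Y"
proof -
  have "conj_transpose X \<bullet> conj_transpose Y = (\<Sum>i\<in>UNIV. \<Sum>j\<in>UNIV. X $ j $ i \<bullet> Y $ j $ i)"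
    by (simp add: inner_vec_def inner_complex_def)
  also have "\<dots> = (\<Sum>j\<in>UNIV. \<Sum>i\<in>UNIV. X $ j $ i \<bullet> Y $ j $ i)"
    by (rule sum.swap)
  finally show ?thesis by (simp add: inner_vec_def)
qed

lemma norm_conj_transpose [simp]: "norm (conj_transpose X) = norm X"
  by (simp add: norm_eq_sqrt_inner)

lemma inner_mult_right:
  fixes M :: "complex^'p^'n" and X :: "complex^'n^'m"
  shows "(X ** M) \<bullet> Y = X \<bullet> (Y ** conj_transpose M)"
proof -
  have "(X ** M) \<bullet> Y = conj_transpose (X ** M) \<bullet> conj_transpose Y"
    by simp
  also have "\<dots> = conj_transpose X \<bullet> conj_transpose (Y ** conj_transpose M)"
    by (simp add: conj_transpose_mul inner_mult_left)
  finally show ?thesis by simp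
qed

lemma norm_matrix_mult_le:
  fixes M :: "complex^'n^'m" and X :: "complex^'p^'n"
  assumes "0 \<le> r" "\<And>x. norm (M *v x) \<le> r * norm x"
  shows "norm (M ** X) \<le> r * norm X"
proof -
  have "(M ** X) \<bullet> (M ** X) \<le> (\<Sum>j\<in>UNIV. (r * norm (column j X))\<^sup>2)"
    unfolding inner_matrix_columns column_matrix_mult
    by (intro sum_mono) (simp add: dot_square_norm power_mono assms)
  also have "\<dots> = r\<^sup>2 * (X \<bullet> X)"
    by (simp add: inner_matrix_columns dot_square_norm power_mult_distrib sum_distrib_left)
  finally have "(norm (M ** X))\<^sup>2 \<le> (r * norm X)\<^sup>2"
    by (simp add: dot_square_norm power_mult_distrib)
  then show ?thesis
    using assms(1) by (intro power2_le_imp_le[of "norm (M ** X)"]) auto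
qed

section \<open>Positive definite matrices\<close>

lemma pos_def_iff:
  "pos_def A \<longleftrightarrow> hermitian A \<and> (\<forall>x. x \<noteq> 0 \<longrightarrow> 0 < x \<bullet> (A *v x))"
  by (simp add: pos_def_def inner_vec_def inner_complex_def)

lemma pos_def_hermitian: "pos_def A \<Longrightarrow> hermitian A"
  by (simp add: pos_def_iff)

text \<open>The quadratic form attains a positive minimum on the compact unit sphere; homogeneity
  extends the bound to all vectors.\<close>

lemma pos_def_coercive:
  fixes A :: "complex^'n^'n"
  assumes "pos_def A"
  obtains c where "0 < c" "\<And>x. c * (x \<bullet> x) \<le> x \<bullet> (A *v x)"
proof -
  let ?S = "sphere (0 :: complex^'n) 1"
  have "continuous_on ?S (\<lambda>x. x \<bullet> (A *v x))"
    by (intro continuous_intros linear_continuous_on linear_linear[THEN iffD2] matrix_vector_mul_linear)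
  moreover have "?S \<noteq> {}"
    by (simp add: sphere_eq_empty)
  ultimately obtain u where u: "u \<in> ?S" "\<And>x. x \<in> ?S \<Longrightarrow> u \<bullet> (A *v u) \<le> x \<bullet> (A *v x)"
    using continuous_attains_inf[of ?S] compact_sphere by blast
  show ?thesis
  proof
    show "0 < u \<bullet> (A *v u)"
      using assms u(1) norm_zero zero_neq_one unfolding pos_def_iff
        by (metis dist_0_norm mem_sphere)
    show "(u \<bullet> (A *v u)) * (x \<bullet> x) \<le> x \<bullet> (A *v x)" for x
    proof (cases "x = 0")
      case False
      have "(u \<bullet> (A *v u)) * (x \<bullet> x) \<le>
          (((1 / norm x) *\<^sub>R x) \<bullet> (A *v ((1 / norm x) *\<^sub>R x))) * (x \<bullet> x)"
        using False by (intro mult_right_mono u(2)) auto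
      also have "\<dots> = x \<bullet> (A *v x)"
        using False by (simp add: matrix_vector_scaleR dot_square_norm power2_eq_square)
      finally show ?thesis .
    qed auto
  qed
qed

lemma pos_defI_coercive:
  fixes A :: "complex^'n^'n"
  assumes "hermitian A" "0 < c" "\<And>x. c * (x \<bullet> x) \<le> x \<bullet> (A *v x)"
  shows "pos_def A"
  unfolding pos_def_iff
proof (intro conjI allI impI assms(1))
  fix x :: "complex^'n" assume "x \<noteq> 0"
  then have "0 < c * (x \<bullet> x)" using assms(2) by simp
  then show "0 < x \<bullet> (A *v x)" using assms(3) by (rule less_le_trans)
qed

lemma inner_matrix_coercive:
  fixes A :: "complex^'n^'n" and D :: "complex^'m^'n"
  assumes "\<And>x. c * (x \<bullet> x) \<le> x \<bullet> (A *v x)"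
  shows "c * (D \<bullet> D) \<le> D \<bullet> (A ** D)"
  unfolding inner_matrix_columns sum_distrib_left column_matrix_mult
  by (intro sum_mono assms)

text \<open>Conjugate transposition preserves the inner product and turns right multiplication by
  \<open>A\<close> into left multiplication.\<close>

lemma inner_matrix_coercive_right:
  fixes A :: "complex^'n^'n" and D :: "complex^'n^'m"
  assumes "hermitian A" "\<And>x. c * (x \<bullet> x) \<le> x \<bullet> (A *v x)"
  shows "c * (D \<bullet> D) \<le> D \<bullet> (D ** A)"
  using inner_matrix_coercive[OF assms(2), of "conj_transpose D"] assms(1)
    inner_conj_transpose[of D "D ** A"]
  by (simp add: conj_transpose_mul hermitian_def)

lemma pos_def_inverse:
  assumes "pos_def A"
  obtains B where "A ** B = mat 1" "B ** A = mat 1" "matrix_inv A = B" "pos_def B"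
proof -
  have "\<forall>x. A *v x = 0 \<longrightarrow> x = 0"
    using assms by (metis inner_zero_right less_irrefl pos_def_iff)
  then obtain B where B: "B ** A = mat 1"
    using matrix_left_invertible_ker[of A] by blast
  then have B': "A ** B = mat 1"
    by (simp add: matrix_left_right_inverse)
  have "matrix_inv A ** A = mat 1"
    unfolding matrix_inv_def by (rule someI2[of _ B]) (use B B' in auto)
  then have inv: "matrix_inv A = B"
    by (metis B' matrix_mul_assoc matrix_mul_lid matrix_mul_rid)
  have h: "hermitian B"
    using B' assms hermitian_inverse pos_def_hermitian by blast
  \<comment> \<open>Positivity of \<open>B\<close> at \<open>x\<close> is positivity of
    \<open>A\<close> at \<open>B *v x\<close>.\<close>
  have "0 < x \<bullet> (B *v x)" if "x \<noteq> 0" for x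
  proof -
    have *: "x = A *v (B *v x)"
      by (simp add: matrix_vector_mul_assoc B')
    then have "B *v x \<noteq> 0"
      using that by (metis matrix_vector_mult_0_right)
    then have "0 < (B *v x) \<bullet> (A *v (B *v x))"
      using assms by (simp add: pos_def_iff)
    then show ?thesis
      using * by (simp add: inner_commute)
  qed
  then have "pos_def B"
    using h by (simp add: pos_def_iff)
  with B B' inv show ?thesis using that by blast
qed

lemma pos_def_congruence:
  fixes A :: "complex^'n^'n" and M :: "complex^'n^'n"
  assumes "pos_def A" "N ** M = mat 1"
  shows "pos_def (conj_transpose M ** A ** M)"
  unfolding pos_def_iff
proof (intro conjI allI impI hermitian_congruence pos_def_hermitian assms(1))
  fix x :: "complex^'n" assume "x \<noteq> 0"
  moreover have "N *v (M *v x) = x"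
    by (simp add: matrix_vector_mul_assoc assms(2))
  ultimately have "M *v x \<noteq> 0"
    by (metis matrix_vector_mult_0_right)
  then have "0 < (M *v x) \<bullet> (A *v (M *v x))"
    using assms(1) by (simp add: pos_def_iff)
  then show "0 < x \<bullet> (conj_transpose M ** A ** M *v x)"
    by (simp add: inner_matrix_vector matrix_vector_mul_assoc matrix_mul_assoc)
qed

lemma pos_def_congruence_hermitian:
  assumes "pos_def A" "hermitian M" "N ** M = mat 1"
  shows "pos_def (M ** A ** M)"
  using pos_def_congruence[OF assms(1,3)] assms(2) by (simp add: hermitian_def)

lemma pos_def_scaleR: "pos_def A \<Longrightarrow> 0 < r \<Longrightarrow> pos_def (r *\<^sub>R A)"
  by (simp add: pos_def_iff hermitian_scaleR scaleR_matrix_vector)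

section \<open>Square roots\<close>

text \<open>After scaling, \<open>A = 1 - X\<close> with \<open>X\<close> a contraction, and \<open>(1 - Y)\<^sup>2 = 1 - X\<close> is the fixed point
  equation \<open>Y = (X + Y\<^sup>2) / 2\<close>. The distance is the Frobenius one, but the operator norm bounds
  the Lipschitz constant.\<close>

lemma pos_def_sqrt_exists:
  fixes A :: "complex^'n^'n"
  assumes "pos_def A"
  shows "\<exists>S. pos_def S \<and> S ** S = A"
proof -
  obtain c where c: "0 < c" "\<And>x. c * (x \<bullet> x) \<le> x \<bullet> (A *v x)"
    using pos_def_coercive[OF assms] by metis
  obtain K0 where K0: "\<And>x. norm (A *v x) \<le> K0 * norm x"
    using linear_bounded[OF matrix_vector_mul_linear[of A]] by blast
  define K where "K = max K0 c"
  have K: "0 < K" "c \<le> K" "norm (A *v x) \<le> K * norm x" for x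
    using c(1) K0[of x] mult_right_mono[of K0 K "norm x"] by (auto simp: K_def)
  \<comment> \<open>By coercivity, \<open>1 - 2 * e * c + e^2 * K^2\<close> bounds the squared
    operator norm of \<open>X\<close>. This \<open>e\<close> minimises it, and the minimum is the
    square of \<open>r\<close>; it is nonnegative because \<open>K\<close> is at least
    \<open>c\<close>.\<close>
  define e where "e = c / K\<^sup>2"
  define r where "r = sqrt (1 - c\<^sup>2 / K\<^sup>2)"
  have "c\<^sup>2 / K\<^sup>2 \<le> 1" "0 < c\<^sup>2 / K\<^sup>2"
    using K c(1) by (auto simp: power_mono)
  then have r: "0 \<le> r" "r < 1" "r\<^sup>2 = 1 - c\<^sup>2 / K\<^sup>2"
    by (auto simp: r_def)
  have e: "0 < e" using c(1) K(1) by (simp add: e_def)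
  define X where "X = mat 1 - e *\<^sub>R A"
  have hX: "hermitian X"
    using assms by (simp add: X_def hermitian_diff hermitian_mat_1 hermitian_scaleR pos_def_hermitian)
  have nX: "norm (X *v x) \<le> r * norm x" for x
  proof -
    have "X *v x = x - e *\<^sub>R (A *v x)"
      by (simp add: X_def matrix_vector_mult_diff_rdistrib scaleR_matrix_vector)
    then have "(norm (X *v x))\<^sup>2 = (norm (x - e *\<^sub>R (A *v x)))\<^sup>2"
      by (rule arg_cong)
    also have "\<dots> = (norm x)\<^sup>2 - 2 * e * (x \<bullet> (A *v x)) + e\<^sup>2 * (norm (A *v x))\<^sup>2"
      by (simp only: power2_norm_eq_inner)
        (simp add: inner_diff inner_commute algebra_simps power2_eq_square)
    also have "\<dots> \<le> (norm x)\<^sup>2 - 2 * e * (c * (norm x)\<^sup>2) + e\<^sup>2 * (K * norm x)\<^sup>2"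
      using c(2)[of x] e K(3)[of x]
      by (intro add_mono diff_mono mult_left_mono power_mono) (auto simp: dot_square_norm)
    also have "\<dots> = (r * norm x)\<^sup>2"
      unfolding power_mult_distrib r(3) using K(1)
      by (simp add: e_def field_simps power2_eq_square)
    finally show ?thesis
      using r(1) by (intro power2_le_imp_le[of "norm (X *v x)"]) auto
  qed
  \<comment> \<open>The bound by \<open>r\<close> is preserved by \<open>f\<close> because
    \<open>(r + r^2) / 2 \<le> r\<close>, and it also makes \<open>f\<close> a contraction with
    constant \<open>r\<close>.\<close>
  define S where "S = {Y::complex^'n^'n. hermitian Y \<and> (\<forall>x. norm (Y *v x) \<le> r * norm x)}"
  define f where "f = (\<lambda>Y. (1/2) *\<^sub>R (X + Y ** Y))"
  have "closed S"
    unfolding S_def hermitian_def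
  proof (intro closed_Collect_conj closed_Collect_all closed_Collect_eq closed_Collect_le continuous_intros)
    have "linear (conj_transpose :: complex^'n^'n \<Rightarrow> _)"
      by (intro linearI conj_transpose_add conj_transpose_scaleR)
    then show "continuous_on UNIV (conj_transpose :: complex^'n^'n \<Rightarrow> _)"
      by (intro linear_continuous_on) (simp add: linear_linear)
    have "linear (\<lambda>Y::complex^'n^'n. Y *v x)" for x
      by (intro linearI matrix_vector_mult_add_rdistrib scaleR_matrix_vector)
    then show "continuous_on UNIV (\<lambda>Y::complex^'n^'n. Y *v x)" for x
      by (intro linear_continuous_on) (simp add: linear_linear)
  qed
  then have "complete S" by (simp add: complete_eq_closed)
  moreover have "S \<noteq> {}" using hX nX by (auto simp: S_def)
  moreover have "f ` S \<subseteq> S"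
  proof clarify
    fix Y assume Y: "Y \<in> S"
    have "norm (f Y *v x) \<le> r * norm x" for x
    proof -
      have "f Y *v x = (1/2) *\<^sub>R (X *v x + Y *v (Y *v x))"
        by (simp add: f_def scaleR_matrix_vector matrix_vector_mult_add_rdistrib matrix_vector_mul_assoc)
      moreover have "norm (Y *v (Y *v x)) \<le> r * (r * norm x)"
        using Y r(1) by (auto simp: S_def intro: order_trans[OF _ mult_left_mono])
      moreover have "r * (r * norm x) \<le> r * norm x"
        using r by (intro mult_left_mono mult_left_le_one_le) auto
      ultimately show ?thesis
        using nX[of x] norm_triangle_ineq[of "X *v x" "Y *v (Y *v x)"] by simp
    qed
    moreover have "hermitian (f Y)"
      using Y hX by (simp add: f_def S_def hermitian_scaleR hermitian_add hermitian_square)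
    ultimately show "f Y \<in> S" by (simp add: S_def)
  qed
  moreover have "\<And>Y Z. Y \<in> S \<and> Z \<in> S \<Longrightarrow> dist (f Y) (f Z) \<le> r * dist Y Z"
  proof -
    fix Y Z assume YZ: "Y \<in> S \<and> Z \<in> S"
    \<comment> \<open>This splitting of \<open>Y ** Y - Z ** Z\<close> respects the order of the
      factors, and each of its two terms is bounded by \<open>r * norm (Y - Z)\<close>.\<close>
    have "f Y - f Z = (1/2) *\<^sub>R (Y ** (Y - Z) + (Y - Z) ** Z)"
      by (simp add: f_def matrix_mul.diff_left matrix_mul.diff_right algebra_simps)
    moreover have "norm (Y ** (Y - Z)) \<le> r * norm (Y - Z)"
      using YZ r(1) by (intro norm_matrix_mult_le) (auto simp: S_def)
    moreover have "norm (Z ** conj_transpose (Y - Z)) \<le> r * norm (Y - Z)"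
      using YZ r(1) norm_matrix_mult_le[of r Z "conj_transpose (Y - Z)"] by (auto simp: S_def)
    moreover have "conj_transpose ((Y - Z) ** Z) = Z ** conj_transpose (Y - Z)"
      using YZ by (simp add: conj_transpose_mul S_def hermitian_def)
    ultimately show "dist (f Y) (f Z) \<le> r * dist Y Z"
      using norm_triangle_ineq[of "Y ** (Y - Z)" "(Y - Z) ** Z"] norm_conj_transpose[of "(Y - Z) ** Z"]
      by (simp add: dist_norm)
  qed
  ultimately obtain Y where Y: "Y \<in> S" "f Y = Y"
    using Banach_fix[of S r f] r by blast
  have YY: "Y ** Y = 2 *\<^sub>R Y - X"
  proof -
    have "2 *\<^sub>R Y = 2 *\<^sub>R f Y" using Y(2) by simp
    then show ?thesis by (simp add: f_def)
  qed
  have sq: "(mat 1 - Y) ** (mat 1 - Y) = e *\<^sub>R A"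
    by (simp add: matrix_mul.diff_left matrix_mul.diff_right YY X_def scaleR_2)
  have "pos_def (mat 1 - Y)"
  proof (rule pos_defI_coercive)
    show "hermitian (mat 1 - Y)"
      using Y(1) by (simp add: S_def hermitian_diff hermitian_mat_1)
    show "0 < 1 - r" using r by simp
    fix x
    have "x \<bullet> (Y *v x) \<le> norm x * norm (Y *v x)" by (rule norm_cauchy_schwarz)
    also have "\<dots> \<le> norm x * (r * norm x)"
      using Y(1) by (intro mult_left_mono) (auto simp: S_def)
    finally show "(1 - r) * (x \<bullet> x) \<le> x \<bullet> ((mat 1 - Y) *v x)"
      by (simp add: matrix_vector_mult_diff_rdistrib inner_diff_right algebra_simps dot_square_norm power2_eq_square)
  qed
  \<comment> \<open>\<open>mat 1 - Y\<close> is a root of the scaled matrix, so division by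
    \<open>sqrt e\<close> gives a root of \<open>A\<close>.\<close>
  then have "pos_def ((1 / sqrt e) *\<^sub>R (mat 1 - Y))"
    using e by (intro pos_def_scaleR) auto
  moreover have "((1 / sqrt e) *\<^sub>R (mat 1 - Y)) ** ((1 / sqrt e) *\<^sub>R (mat 1 - Y)) = A"
    using e by (simp add: matrix_mul.scaleR_left matrix_mul.scaleR_right sq)
  ultimately show ?thesis by blast
qed

text \<open>The difference \<open>D\<close> satisfies
  \<open>S ** D + D ** T = S ** S - T ** T = 0\<close>, and pairing this with \<open>D\<close>
  forces \<open>D = 0\<close> by coercivity.\<close>

lemma pos_def_sqrt_unique:
  fixes S T :: "complex^'n^'n"
  assumes S: "pos_def S" and T: "pos_def T" and eq: "S ** S = T ** T"
  shows "S = T"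
proof -
  let ?D = "S - T"
  obtain c where c: "0 < c" "\<And>x. c * (x \<bullet> x) \<le> x \<bullet> (S *v x)"
    using pos_def_coercive[OF S] by metis
  obtain d where d: "0 < d" "\<And>x. d * (x \<bullet> x) \<le> x \<bullet> (T *v x)"
    using pos_def_coercive[OF T] by metis
  have "S ** ?D + ?D ** T = 0"
    by (simp add: matrix_mul.diff_left matrix_mul.diff_right eq)
  then have "?D \<bullet> (S ** ?D) + ?D \<bullet> (?D ** T) = 0"
    by (metis inner_add_right inner_zero_right)
  moreover have "c * (?D \<bullet> ?D) \<le> ?D \<bullet> (S ** ?D)"
    by (rule inner_matrix_coercive[OF c(2)])
  moreover have "d * (?D \<bullet> ?D) \<le> ?D \<bullet> (?D ** T)"
    by (rule inner_matrix_coercive_right[OF pos_def_hermitian[OF T] d(2)])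
  ultimately have "(c + d) * (?D \<bullet> ?D) \<le> 0"
    by (simp add: distrib_right)
  then have "?D \<bullet> ?D = 0"
    using c(1) d(1) inner_ge_zero[of ?D] by (simp add: mult_le_0_iff)
  then show ?thesis by simp
qed

lemma pd_sqrt:
  assumes "pos_def A"
  shows "pos_def (pd_sqrt A)" "pd_sqrt A ** pd_sqrt A = A"
proof -
  have "\<exists>!S. pos_def S \<and> S ** S = A"
    using pos_def_sqrt_exists[OF assms] pos_def_sqrt_unique by metis
  from theI'[OF this] show "pos_def (pd_sqrt A)" "pd_sqrt A ** pd_sqrt A = A"
    by (auto simp: pd_sqrt_def)
qed

text \<open>A minimiser of the Rayleigh quotient on the unit sphere of \<open>W\<close> is an
  eigenvector. Here \<open>W\<close> is a real subspace, which is enough because the eigenvalue is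
  real.\<close>

lemma hermitian_eigenvector:
  fixes K :: "complex^'n^'n" and W :: "(complex^'n) set"
  assumes K: "hermitian K" and W: "subspace W" "\<And>x. x \<in> W \<Longrightarrow> K *v x \<in> W" and "w \<in> W" "w \<noteq> 0"
  obtains u where "u \<in> W" "u \<noteq> 0" "K *v u = (u \<bullet> (K *v u)) *\<^sub>R u"
proof -
  let ?S = "sphere 0 1 \<inter> W"
  have "compact ?S"
    by (intro compact_Int_closed compact_sphere closed_subspace W)
  moreover have "(1 / norm w) *\<^sub>R w \<in> ?S"
    using assms by (simp add: subspace_scale)
  moreover have "continuous_on ?S (\<lambda>x. x \<bullet> (K *v x))"
    by (intro continuous_intros linear_continuous_on linear_linear[THEN iffD2] matrix_vector_mul_linear)
  ultimately obtain u where u: "u \<in> ?S" "\<And>x. x \<in> ?S \<Longrightarrow> u \<bullet> (K *v u) \<le> x \<bullet> (K *v x)"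
    using continuous_attains_inf[of ?S] by blast
  define l where "l = u \<bullet> (K *v u)"
  have nu: "u \<bullet> u = 1" and uW: "u \<in> W"
    using u(1) by (auto simp: norm_eq_1)
  have q: "l * (x \<bullet> x) \<le> x \<bullet> (K *v x)" if "x \<in> W" for x
  proof (cases "x = 0")
    case False
    have "l * (x \<bullet> x) \<le> (((1 / norm x) *\<^sub>R x) \<bullet> (K *v ((1 / norm x) *\<^sub>R x))) * (x \<bullet> x)"
      unfolding l_def using False that W by (intro mult_right_mono u(2)) (auto simp: subspace_scale)
    also have "\<dots> = x \<bullet> (K *v x)"
      using False by (simp add: matrix_vector_scaleR dot_square_norm power2_eq_square)
    finally show ?thesis .
  qed auto
  \<comment> \<open>The residual \<open>v\<close> is half the gradient direction of
    \<open>x \<bullet> (K *v x) - l * (x \<bullet> x)\<close> at \<open>u\<close>. It stays in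
    \<open>W\<close>, so moving along it cannot make this expression negative.\<close>
  define v where "v = K *v u - l *\<^sub>R u"
  have vW: "v \<in> W"
    using W uW by (simp add: v_def subspace_diff subspace_scale)
  have "0 \<le> 2 * t * (v \<bullet> v) + t\<^sup>2 * (v \<bullet> (K *v v) - l * (v \<bullet> v))" for t
  proof -
    have "l * ((u + t *\<^sub>R v) \<bullet> (u + t *\<^sub>R v)) \<le> (u + t *\<^sub>R v) \<bullet> (K *v (u + t *\<^sub>R v))"
      using W uW vW by (intro q) (simp add: subspace_add subspace_scale)
    moreover have "u \<bullet> (K *v v) = v \<bullet> (K *v u)"
      using hermitian_inner[OF K, of u v] by (simp add: inner_commute)
    ultimately have "l * (1 + 2 * t * (u \<bullet> v) + t\<^sup>2 * (v \<bullet> v))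
        \<le> l + 2 * t * (v \<bullet> (K *v u)) + t\<^sup>2 * (v \<bullet> (K *v v))"
      using nu by (simp add: matrix_vector_right_distrib matrix_vector_scaleR inner_add
          l_def[symmetric] inner_commute power2_eq_square algebra_simps)
    moreover have "v \<bullet> (K *v u) = v \<bullet> v + l * (u \<bullet> v)"
      by (subst (3) v_def) (simp add: inner_diff_right inner_commute)
    ultimately show ?thesis
      by (simp only:) (simp add: algebra_simps)
  qed
  note nonneg = this
  have "v \<bullet> v = 0"
  proof (rule ccontr)
    define b where "b = v \<bullet> (K *v v) - l * (v \<bullet> v)"
    \<comment> \<open>A negative step, so short that the linear term of the expansion dominates the
      quadratic one.\<close>
    define t where "t = - (v \<bullet> v) / (\<bar>b\<bar> + 1)"
    assume "v \<bullet> v \<noteq> 0"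
    then have a: "0 < v \<bullet> v" by (simp add: order_less_le)
    then have t: "t < 0" by (simp add: t_def)
    have "\<bar>t * b\<bar> \<le> v \<bullet> v"
      using a by (simp add: t_def abs_mult field_simps)
    then have "0 < 2 * (v \<bullet> v) + t * b" using a by linarith
    then have "t * (2 * (v \<bullet> v) + t * b) < 0" using t by (simp add: mult_less_0_iff)
    moreover have "0 \<le> t * (2 * (v \<bullet> v) + t * b)"
      using nonneg[of t] by (simp add: b_def algebra_simps power2_eq_square)
    ultimately show False by simp
  qed
  then have "K *v u = l *\<^sub>R u" by (simp add: v_def)
  moreover have "u \<noteq> 0" using nu by auto
  ultimately show ?thesis using that[OF uW] by (simp add: l_def)
qed

text \<open>The real inner product sees only real parts: pairing \<open>c *s w\<close> with
  \<open>w\<close> gives \<open>Re c\<close>, and pairing it with \<open>\<i> *s w\<close> gives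
  \<open>Im c\<close>, each times the squared norm \<open>N\<close>.\<close>

lemma pos_def_eigval_pos:
  assumes "pos_def K" "eigval K c"
  shows "\<exists>r::real. 0 < r \<and> c = of_real r"
proof -
  obtain w where w: "w \<noteq> 0" "K *v w = c *s w"
    using assms(2) by (auto simp: eigval_def)
  define N where "N = (\<Sum>i\<in>UNIV. (Re (w $ i))\<^sup>2 + (Im (w $ i))\<^sup>2)"
  have N: "Re c * N = w \<bullet> (c *s w)" "Im c * N = (\<i> *s w) \<bullet> (c *s w)" "0 \<le> N"
    by (auto simp: N_def inner_vec_def inner_complex_def sum_distrib_left
        algebra_simps power2_eq_square intro!: sum_nonneg)
  have pos: "0 < Re c * N"
    using assms(1) w by (simp add: N(1) pos_def_iff flip: w(2))
  \<comment> \<open>As \<open>K\<close> is Hermitian, this number equals its own negative.\<close>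
  have "(\<i> *s w) \<bullet> (K *v w) = - (w \<bullet> (K *v (\<i> *s w)))"
    by (simp add: vec.scale inner_vec_def inner_complex_def flip: sum_negf)
  also have "\<dots> = - ((K *v w) \<bullet> (\<i> *s w))"
    using assms(1) by (simp add: hermitian_inner pos_def_hermitian)
  finally have "Im c * N = 0"
    by (simp add: N(2) inner_commute w(2))
  with pos N(3) have "Im c = 0" "0 < Re c"
    by (auto simp: zero_less_mult_iff)
  then show ?thesis
    by (intro exI[of _ "Re c"]) (simp add: complex_eq_iff)
qed

text \<open>\<open>N\<close> carries an eigenvector of \<open>M ** K ** N\<close> to one of
  \<open>K\<close> with the same eigenvalue.\<close>

lemma pos_eigvals_similar:
  fixes K M N :: "complex^'n^'n"
  assumes "pos_def K" "N ** M = mat 1"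
  shows "pos_eigvals (M ** K ** N)"
  unfolding pos_eigvals_def
proof (intro allI impI)
  fix c assume "eigval (M ** K ** N) c"
  then obtain v where v: "v \<noteq> 0" "(M ** K ** N) *v v = c *s v"
    by (auto simp: eigval_def)
  have MN: "M ** N = mat 1" using assms(2) by (simp add: matrix_left_right_inverse)
  have "K *v (N *v v) = N *v ((M ** K ** N) *v v)"
    by (simp add: matrix_vector_mul_assoc matrix_mul_assoc assms(2))
  then have "K *v (N *v v) = c *s (N *v v)"
    by (simp add: v(2) vec.scale)
  moreover have "M *v (N *v v) = v"
    by (simp add: matrix_vector_mul_assoc MN)
  then have "N *v v \<noteq> 0"
    using v(1) by (metis matrix_vector_mult_0_right)
  ultimately show "\<exists>r::real. 0 < r \<and> c = of_real r"
    using assms(1) pos_def_eigval_pos unfolding eigval_def by blast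
qed

text \<open>If \<open>S\<close> and \<open>T = M K M\<^sup>-\<^sup>1\<close> have the same square, then \<open>E = (S - T) M\<close> satisfies \<open>S E = - E K\<close>.
  Hence \<open>K\<close> leaves the orthogonal complement of the kernel of \<open>E\<close> invariant, and \<open>E\<close> would map an
  eigenvector of \<open>K\<close> found there to an eigenvector of \<open>S\<close> with negative eigenvalue.\<close>

lemma pe_sqrt_similar:
  fixes K M N :: "complex^'n^'n"
  assumes K: "pos_def K" and NM: "N ** M = mat 1"
  shows "pe_sqrt (M ** K ** K ** N) = M ** K ** N"
  unfolding pe_sqrt_def
proof (rule the_equality)
  let ?T = "M ** K ** N"
  have MN: "M ** N = mat 1" using NM by (simp add: matrix_left_right_inverse)
  have TT: "?T ** ?T = M ** K ** K ** N"
    by (metis NM matrix_mul_assoc matrix_mul_rid)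
  show "pos_eigvals ?T \<and> ?T ** ?T = M ** K ** K ** N"
    using TT pos_eigvals_similar[OF K NM] by simp
  fix S assume S: "pos_eigvals S \<and> S ** S = M ** K ** K ** N"
  define E where "E = (S - ?T) ** M"
  have "?T ** M = M ** K"
    by (metis NM matrix_mul_assoc matrix_mul_rid)
  have "S ** (S - ?T) = - ((S - ?T) ** ?T)"
    using S TT by (simp add: matrix_mul.diff_left matrix_mul.diff_right)
  then have "S ** E = - ((S - ?T) ** (?T ** M))"
    by (simp add: E_def matrix_mul_assoc matrix_mul.minus_left)
  then have SE: "S ** E = - (E ** K)"
    unfolding \<open>?T ** M = M ** K\<close> by (simp add: E_def matrix_mul_assoc)
  have minus: "(- (E ** K)) *v x = - ((E ** K) *v x)" for x
    by (simp add: vec_eq_iff matrix_vector_mult_def sum_negf)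
  have SEv: "S *v (E *v x) = - (E *v (K *v x))" for x
    by (simp add: matrix_vector_mul_assoc SE minus)
  have "E *v x = 0" for x
  proof (rule ccontr)
    assume "E *v x \<noteq> 0"
    define Z where "Z = {y. E *v y = 0}"
    \<comment> \<open>The component of \<open>x\<close> in \<open>W\<close> is nonzero because
      \<open>E\<close> does not annihilate \<open>x\<close>.\<close>
    define W where "W = {y. \<forall>z\<in>Z. y \<bullet> z = 0}"
    have "subspace Z"
      by (auto simp: Z_def subspace_def matrix_vector_right_distrib matrix_vector_scaleR)
    obtain z w where zw: "z \<in> span Z" "\<And>y. y \<in> span Z \<Longrightarrow> orthogonal w y" "x = z + w"
      using orthogonal_subspace_decomp_exists[of Z x] by metis
    then have "w \<in> W" "z \<in> Z"
      using span_eq_iff[THEN iffD2, OF \<open>subspace Z\<close>] by (auto simp: W_def orthogonal_def)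
    moreover have "w \<noteq> 0"
      using zw(3) \<open>z \<in> Z\<close> \<open>E *v x \<noteq> 0\<close> by (auto simp: Z_def)
    moreover have "subspace W"
      by (auto simp: W_def subspace_def inner_add)
    moreover have "K *v y \<in> W" if "y \<in> W" for y
    proof -
      have "K *v z \<in> Z" if "z \<in> Z" for z
        using that SEv[of z] by (simp add: Z_def)
      then show ?thesis
        using \<open>y \<in> W\<close> K by (simp add: W_def hermitian_inner pos_def_hermitian)
    qed
    ultimately obtain u where u: "u \<in> W" "u \<noteq> 0" "K *v u = (u \<bullet> (K *v u)) *\<^sub>R u"
      using hermitian_eigenvector[OF pos_def_hermitian[OF K]] by metis
    define l where "l = u \<bullet> (K *v u)"
    have l: "0 < l" using K u(2) by (simp add: l_def pos_def_iff)
    have "E *v u \<noteq> 0"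
      using u(1,2) by (auto simp: W_def Z_def)
    moreover have "S *v (E *v u) = - (E *v (l *\<^sub>R u))"
      unfolding SEv l_def by (subst u(3)) simp
    then have "S *v (E *v u) = of_real (- l) *s (E *v u)"
      unfolding matrix_vector_scaleR
      by (simp add: vec_eq_iff scaleR_conv_of_real[where 'a = complex])
    ultimately have "eigval S (of_real (- l))"
      unfolding eigval_def by blast
    then obtain r :: real where "0 < r" "complex_of_real (- l) = of_real r"
      using S unfolding pos_eigvals_def by blast
    then show False using l by (simp only: of_real_eq_iff)
  qed
  then have "E = 0" by (simp add: matrix_eq)
  then have "(S - ?T) ** (M ** N) = 0"
    by (simp add: E_def matrix_mul_assoc)
  then show "S = ?T" by (simp add: MN)
qed

section \<open>The matrix exponential\<close>

text \<open>The constant \<open>C\<close> of bounded bilinearity gives geometric growth of the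
  powers, so the exponential series of \<open>norm A * C\<close> is a majorant.\<close>

lemma summable_norm_mat_exp:
  fixes A :: "complex^'n^'n"
  shows "summable (\<lambda>k. norm ((1 / fact k) *\<^sub>R mat_pow A k))"
proof -
  obtain C where C: "0 < C" "\<And>(X :: complex^'n^'n) (Y :: complex^'n^'n). norm (X ** Y) \<le> norm X * norm Y * C"
    using matrix_mul.pos_bounded by metis
  have bound: "norm (mat_pow A k) \<le> norm (mat 1 :: complex^'n^'n) * (norm A * C) ^ k" for k
  proof (induction k)
    case (Suc k)
    have "norm (mat_pow A (Suc k)) \<le> norm (mat_pow A k) * (norm A * C)"
      using C(2)[of A "mat_pow A k"] by (simp add: algebra_simps)
    also have "\<dots> \<le> (norm (mat 1 :: complex^'n^'n) * (norm A * C) ^ k) * (norm A * C)"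
      using C(1) Suc by (intro mult_right_mono) auto
    finally show ?case by (simp add: algebra_simps)
  qed simp
  show ?thesis
  proof (rule summable_comparison_test)
    show "\<exists>N. \<forall>n\<ge>N. norm (norm ((1 / fact n) *\<^sub>R mat_pow A n))
        \<le> norm (mat 1 :: complex^'n^'n) * (inverse (fact n) * (norm A * C) ^ n)"
      using bound by (auto simp: field_simps)
    show "summable (\<lambda>n. norm (mat 1 :: complex^'n^'n) * (inverse (fact n) * (norm A * C) ^ n))"
      by (intro summable_mult summable_exp)
  qed
qed

lemmas summable_mat_exp = summable_norm_mat_exp[THEN summable_norm_cancel]

lemma mat_pow_scaleR: "mat_pow (r *\<^sub>R A) k = r ^ k *\<^sub>R mat_pow A k"
  by (induction k) (simp_all add: matrix_mul.scaleR_left matrix_mul.scaleR_right)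

lemma mat_pow_commute: "mat_pow A k ** A = A ** mat_pow A k"
  by (induction k) (simp_all flip: matrix_mul_assoc)

lemma mat_exp_commute: "mat_exp (r *\<^sub>R A) ** A = A ** mat_exp (r *\<^sub>R A)"
proof -
  note s = summable_mat_exp[of "r *\<^sub>R A"]
  have "mat_exp (r *\<^sub>R A) ** A = (\<Sum>k. ((1 / fact k) *\<^sub>R mat_pow (r *\<^sub>R A) k) ** A)"
    unfolding mat_exp_def by (rule bounded_linear.suminf[OF matrix_mul.bounded_linear_left s])
  also have "\<dots> = (\<Sum>k. A ** ((1 / fact k) *\<^sub>R mat_pow (r *\<^sub>R A) k))"
    by (simp add: mat_pow_scaleR matrix_mul.scaleR_left matrix_mul.scaleR_right mat_pow_commute)
  also have "\<dots> = A ** mat_exp (r *\<^sub>R A)"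
    unfolding mat_exp_def by (rule bounded_linear.suminf[OF matrix_mul.bounded_linear_right s, symmetric])
  finally show ?thesis .
qed

lemma mat_exp_0: "mat_exp 0 = mat 1"
proof -
  have "mat_exp (0 :: complex^'a^'a) = (\<Sum>k\<in>{0}. (1 / fact k) *\<^sub>R mat_pow 0 k)"
    unfolding mat_exp_def
  proof (rule suminf_finite)
    fix k :: nat assume "k \<notin> {0}"
    then show "(1 / fact k) *\<^sub>R mat_pow (0 :: complex^'a^'a) k = 0"
      by (cases k) auto
  qed simp
  then show ?thesis by simp
qed

lemma has_vector_derivative_matrixI:
  fixes f :: "real \<Rightarrow> complex^'n^'m"
  assumes "\<And>i j. ((\<lambda>t. f t $ i $ j) has_vector_derivative D $ i $ j) (at t)"
  shows "(f has_vector_derivative D) (at t)"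
  unfolding has_vector_derivative_def has_derivative_def
proof (intro conjI vec_tendstoI)
  show "bounded_linear (\<lambda>h. h *\<^sub>R D)"
    by (rule bounded_linear_scaleR_left)
  show "((\<lambda>y. ((f y - f (netlimit (at t)) - (y - netlimit (at t)) *\<^sub>R D) /\<^sub>R norm (y - netlimit (at t))) $ i $ j) \<longlongrightarrow> 0 $ i $ j) (at t)" for i j
    using assms[of i j] by (simp add: has_vector_derivative_def has_derivative_def)
qed

text \<open>Each entry is a complex power series in \<open>t\<close> that converges everywhere, so
  the scalar theorem on termwise differentiation applies.\<close>

lemma has_vector_derivative_mat_exp:
  fixes A :: "complex^'n^'n"
  shows "((\<lambda>t. mat_exp (t *\<^sub>R A)) has_vector_derivative A ** mat_exp (t *\<^sub>R A)) (at t)"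
proof (rule has_vector_derivative_matrixI)
  fix i j
  define c where "c k = (1 / fact k) *\<^sub>R (mat_pow A k $ i $ j)" for k
  have nth: "bounded_linear (\<lambda>Z::complex^'n^'n. Z $ i $ j)"
    by (intro bounded_linear_compose[OF bounded_linear_vec_nth] bounded_linear_vec_nth)
  have entry: "(\<lambda>k. c k * of_real s ^ k) sums (mat_exp (s *\<^sub>R A) $ i $ j)" for s
    using bounded_linear.sums[OF nth summable_sums[OF summable_mat_exp[of "s *\<^sub>R A"]]]
    unfolding mat_exp_def mat_pow_scaleR vector_scaleR_component
    by (simp add: c_def scaleR_conv_of_real[where 'a = complex] mult_ac)
  have "summable (\<lambda>k. c k * y ^ k)" for y
  proof (rule summable_comparison_test[OF _ summable_norm_mat_exp[of "norm y *\<^sub>R A"]], intro exI allI impI)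
    fix k :: nat
    have "norm (c k * y ^ k) = norm (((1 / fact k) *\<^sub>R mat_pow (norm y *\<^sub>R A) k) $ i $ j)"
      by (simp add: c_def mat_pow_scaleR norm_mult norm_power mult_ac)
    also have "\<dots> \<le> norm (((1 / fact k) *\<^sub>R mat_pow (norm y *\<^sub>R A) k) $ i)"
      by (rule Finite_Cartesian_Product.norm_nth_le)
    also have "\<dots> \<le> norm ((1 / fact k) *\<^sub>R mat_pow (norm y *\<^sub>R A) k)"
      by (rule Finite_Cartesian_Product.norm_nth_le)
    finally show "norm (c k * y ^ k) \<le> norm ((1 / fact k) *\<^sub>R mat_pow (norm y *\<^sub>R A) k)" .
  qed
  then have "((\<lambda>z. \<Sum>k. c k * z ^ k) has_field_derivative (\<Sum>k. diffs c k * of_real t ^ k)) (at (of_real t))"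
    by (rule termdiffs_strong_converges_everywhere)
  then have "((\<lambda>s. \<Sum>k. c k * of_real s ^ k) has_vector_derivative (\<Sum>k. diffs c k * of_real t ^ k)) (at t)"
    by (rule has_vector_derivative_real_field)
  moreover have "(\<lambda>k. diffs c k * of_real t ^ k) sums ((A ** mat_exp (t *\<^sub>R A)) $ i $ j)"
  proof -
    have "(\<lambda>k. (A ** ((1 / fact k) *\<^sub>R mat_pow (t *\<^sub>R A) k)) $ i $ j) sums ((A ** mat_exp (t *\<^sub>R A)) $ i $ j)"
      unfolding mat_exp_def
      by (intro bounded_linear.sums[OF nth] bounded_linear.sums[OF matrix_mul.bounded_linear_right]
          summable_sums summable_mat_exp)
    \<comment> \<open>\<open>diffs\<close> shifts the index by one and multiplies by
      \<open>Suc k\<close>: the shift supplies the factor \<open>A\<close> of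
      \<open>mat_pow A (Suc k)\<close>, and the multiplier cancels against the factorial.\<close>
    moreover have "(A ** ((1 / fact k) *\<^sub>R mat_pow (t *\<^sub>R A) k)) $ i $ j = diffs c k * of_real t ^ k" for k
      unfolding mat_pow_scaleR matrix_mul.scaleR_right vector_scaleR_component
      by (simp add: diffs_def c_def scaleR_conv_of_real[where 'a = complex] del: of_nat_Suc)
    ultimately show ?thesis by simp
  qed
  ultimately show "((\<lambda>t. mat_exp (t *\<^sub>R A) $ i $ j) has_vector_derivative
      (A ** mat_exp (t *\<^sub>R A)) $ i $ j) (at t)"
    using entry by (simp add: sums_iff)
qed

lemma has_vector_derivative_mat_exp_minus:
  fixes A :: "complex^'n^'n"
  shows "((\<lambda>t. mat_exp ((- t) *\<^sub>R A)) has_vector_derivative - (A ** mat_exp ((- t) *\<^sub>R A))) (at t)"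
  using has_vector_derivative_mat_exp[of "- A" t] by (simp add: matrix_mul.minus_left)

section \<open>The Lyapunov equation\<close>

text \<open>An energy estimate: the derivative of \<open>f s \<bullet> f s\<close> is at most
  \<open>- 4 * c\<close> times itself, as \<open>K\<close> contributes \<open>c\<close> from each
  side and the square doubles it. Hence \<open>\<phi>\<close> does not increase.\<close>

lemma lyapunov_decay:
  fixes f :: "real \<Rightarrow> complex^'n^'n"
  assumes K: "hermitian K" "\<And>x. c * (x \<bullet> x) \<le> x \<bullet> (K *v x)"
    and f: "\<And>t. (f has_vector_derivative - (K ** f t + f t ** K)) (at t)"
    and t: "0 \<le> t"
  shows "norm (f t) \<le> exp (- 2 * c * t) * norm (f 0)"
proof -
  define \<phi> where "\<phi> s = exp (4 * c * s) * (f s \<bullet> f s)" for s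
  have "\<phi> t \<le> \<phi> 0"
  proof (rule DERIV_nonpos_imp_nonincreasing[OF t])
    fix s
    let ?g = "K ** f s + f s ** K"
    have "(\<phi> has_real_derivative exp (4 * c * s) * (4 * c * (f s \<bullet> f s) - 2 * (f s \<bullet> ?g))) (at s)"
      unfolding \<phi>_def has_field_derivative_def
      by (rule derivative_eq_intros f[unfolded has_vector_derivative_def] refl)+
        (simp add: fun_eq_iff inner_commute algebra_simps)
    moreover have "2 * c * (f s \<bullet> f s) \<le> f s \<bullet> ?g"
      using inner_matrix_coercive[OF K(2), of "f s"] inner_matrix_coercive_right[OF K, of "f s"]
      by (simp add: inner_add_right)
    then have "exp (4 * c * s) * (4 * c * (f s \<bullet> f s) - 2 * (f s \<bullet> ?g)) \<le> 0"
      by (simp add: mult_le_0_iff)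
    ultimately show "\<exists>y. (\<phi> has_real_derivative y) (at s) \<and> y \<le> 0" by blast
  qed
  moreover have "exp (4 * c * t) = (exp (2 * c * t))\<^sup>2"
    by (simp flip: exp_double)
  ultimately have "(exp (2 * c * t) * norm (f t))\<^sup>2 \<le> (norm (f 0))\<^sup>2"
    by (simp add: \<phi>_def power_mult_distrib dot_square_norm)
  then have "exp (2 * c * t) * norm (f t) \<le> norm (f 0)"
    by (rule power2_le_imp_le) simp
  then show ?thesis by (simp add: exp_minus field_simps)
qed

text \<open>With \<open>L D = K ** D + D ** K\<close> one has \<open>L (f t) = - f' t\<close>, so
  the fundamental theorem of calculus gives \<open>f 0 - f b\<close> over \<open>{0..b}\<close>.
  Decay allows \<open>b\<close> to tend to infinity.\<close>

lemma lyapunov_integral: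
  fixes f :: "real \<Rightarrow> complex^'n^'n"
  assumes K: "pos_def K"
    and f: "\<And>t. (f has_vector_derivative - (K ** f t + f t ** K)) (at t)"
  shows "set_integrable lborel {0..} f"
    and "K ** (LBINT t:{0..}. f t) + (LBINT t:{0..}. f t) ** K = f 0"
proof -
  obtain c where c: "0 < c" "\<And>x. c * (x \<bullet> x) \<le> x \<bullet> (K *v x)"
    using pos_def_coercive[OF K] by metis
  have decay: "norm (f t) \<le> exp (- (2 * c) * t) * norm (f 0)" if "0 \<le> t" for t
    using lyapunov_decay[OF pos_def_hermitian[OF K] c(2) f that] by simp
  have cont: "continuous_on S f" for S
    using f by (meson continuous_at_imp_continuous_on has_vector_derivative_continuous)
  have "(\<lambda>t. exp (- (2 * c) * t)) absolutely_integrable_on {0..}"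
    using c(1) by (intro nonnegative_absolutely_integrable_1 integrable_on_exp_minus_to_infinity) auto
  then have "set_integrable lborel {0..} (\<lambda>t. exp (- (2 * c) * t))"
    unfolding set_integrable_def by (subst (asm) integrable_completion) auto
  then have "set_integrable lborel {0..} (\<lambda>t. exp (- (2 * c) * t) * norm (f 0))"
    by (rule set_integrable_mult_left)
  then show int: "set_integrable lborel {0..} f"
  proof (rule set_integrable_bound)
    show "set_borel_measurable lborel {0..} f"
      using borel_measurable_continuous_onI[OF cont] unfolding set_borel_measurable_def by simp
    show "AE t in lborel. t \<in> {0..} \<longrightarrow> norm (f t) \<le> norm (exp (- (2 * c) * t) * norm (f 0))"
      using decay by simp
  qed
  define L where "L D = K ** D + D ** K" for D
  have L: "bounded_linear L"
    unfolding L_def by (intro bounded_linear_add matrix_mul.bounded_linear_right matrix_mul.bounded_linear_left)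
  have "L (LBINT t:{0..b}. f t) = f 0 - f b" if "0 \<le> b" for b
  proof -
    have "set_integrable lborel {0..b} f"
      by (rule set_integrable_subset[OF int]) auto
    then have "L (LBINT t:{0..b}. f t) = (LBINT t:{0..b}. L (f t))"
      unfolding set_lebesgue_integral_def set_integrable_def
      by (simp add: integral_bounded_linear[OF L, symmetric] linear_scale[OF bounded_linear.linear[OF L]])
    also have "\<dots> = (- f b) - (- f 0)"
      unfolding set_lebesgue_integral_def
    proof (rule integral_FTC_Icc[OF that])
      show "((\<lambda>t. - f t) has_vector_derivative L (f t)) (at t within {0..b})" for t
        unfolding L_def
        by (rule has_vector_derivative_at_within)
          (use has_vector_derivative_minus[OF f[of t]] in \<open>simp only: minus_minus\<close>)
      show "continuous_on {0..b} (\<lambda>t. L (f t))"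
        by (intro bounded_linear.continuous_on[OF L] cont)
    qed
    finally show ?thesis by simp
  qed
  then have "\<forall>\<^sub>F b in at_top. f 0 - f b = L (LBINT t:{0..b}. f t)"
    by (intro eventually_at_top_linorderI[of 0]) auto
  moreover have "((\<lambda>b. L (LBINT t:{0..b}. f t)) \<longlongrightarrow> L (LBINT t:{0..}. f t)) at_top"
    by (intro bounded_linear.tendsto[OF L] tendsto_set_lebesgue_integral_at_top int) auto
  ultimately have "((\<lambda>b. f 0 - f b) \<longlongrightarrow> L (LBINT t:{0..}. f t)) at_top"
    by (simp add: tendsto_cong)
  moreover have "(f \<longlongrightarrow> 0) at_top"
  proof (rule Lim_null_comparison)
    show "\<forall>\<^sub>F b in at_top. norm (f b) \<le> exp (- (2 * c) * b) * norm (f 0)"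
      using decay by (intro eventually_at_top_linorderI[of 0]) auto
    have "filterlim (\<lambda>b. 2 * c * b) at_top at_top"
      using c(1) by (intro filterlim_tendsto_pos_mult_at_top[OF tendsto_const _ filterlim_ident]) simp
    then have "filterlim (\<lambda>b. - (2 * c * b)) at_bot at_top"
      by (rule filterlim_compose[OF filterlim_uminus_at_bot_at_top])
    then have "((\<lambda>b. exp (- (2 * c * b))) \<longlongrightarrow> 0) at_top"
      by (rule filterlim_compose[OF exp_at_bot])
    then have "((\<lambda>b. exp (- (2 * c * b)) * norm (f 0)) \<longlongrightarrow> 0) at_top"
      by (rule tendsto_mult_left_zero)
    then show "((\<lambda>b. exp (- (2 * c) * b) * norm (f 0)) \<longlongrightarrow> 0) at_top" by simp
  qed
  then have "((\<lambda>b. f 0 - f b) \<longlongrightarrow> f 0 - 0) at_top"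
    by (intro tendsto_diff tendsto_const)
  ultimately have "L (LBINT t:{0..}. f t) = f 0 - 0"
    using tendsto_unique trivial_limit_at_top_linorder by blast
  then show "K ** (LBINT t:{0..}. f t) + (LBINT t:{0..}. f t) ** K = f 0"
    by (simp add: L_def)
qed

text \<open>The identities \<open>R ** P = K ** R\<close> and \<open>Q ** R = R ** K\<close> turn
  the equation for \<open>F\<close> into the Lyapunov equation for \<open>f\<close>.\<close>

lemma sylvester_integral:
  fixes K M R C :: "complex^'n^'n"
  assumes K: "pos_def K" and MR: "M ** R = mat 1"
  defines "P \<equiv> M ** K ** R" and "Q \<equiv> R ** K ** M"
  defines "F \<equiv> \<lambda>t. mat_exp ((- t) *\<^sub>R P) ** C ** mat_exp ((- t) *\<^sub>R Q)"
  shows "set_integrable lborel {0..} F"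
    and "P ** (LBINT t:{0..}. F t) + (LBINT t:{0..}. F t) ** Q = C"
proof -
  have RM: "R ** M = mat 1" using MR by (simp add: matrix_left_right_inverse)
  have cancel: "M ** (R ** Z) = Z" "R ** (M ** Z) = Z" for Z :: "complex^'n^'n"
    by (simp_all add: matrix_mul_assoc MR RM)
  define f where "f t = R ** F t ** R" for t
  have F': "(F has_vector_derivative - (P ** F t + F t ** Q)) (at t)" for t
  proof -
    let ?p = "mat_exp ((- t) *\<^sub>R P)" and ?q = "mat_exp ((- t) *\<^sub>R Q)"
    have "(F has_vector_derivative (?p ** C) ** - (Q ** ?q) + (?p ** 0 + - (P ** ?p) ** C) ** ?q) (at t)"
      unfolding F_def
      by (intro matrix_mul.has_vector_derivative has_vector_derivative_mat_exp_minus has_vector_derivative_const)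
    \<comment> \<open>The derivative of the right exponential puts \<open>Q\<close> on its left;
      commuting them moves \<open>Q\<close> to the outside.\<close>
    moreover have "(?p ** C) ** - (Q ** ?q) + (?p ** 0 + - (P ** ?p) ** C) ** ?q = - (P ** F t + F t ** Q)"
      using mat_exp_commute[of "- t" Q]
      by (simp add: F_def matrix_mul.minus_left matrix_mul.minus_right flip: matrix_mul_assoc)
    ultimately show ?thesis by simp
  qed
  have "(f has_vector_derivative - (K ** f t + f t ** K)) (at t)" for t
  proof -
    have "bounded_linear (\<lambda>Z. R ** Z ** R)"
      by (intro bounded_linear_compose[OF matrix_mul.bounded_linear_left] matrix_mul.bounded_linear_right)
    from bounded_linear.has_vector_derivative[OF this F'[of t]]
    have "(f has_vector_derivative R ** - (P ** F t + F t ** Q) ** R) (at t)"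
      unfolding f_def .
    moreover have "R ** - (P ** F t + F t ** Q) ** R = - (K ** f t + f t ** K)"
      by (simp add: matrix_mul.minus_left matrix_mul.minus_right matrix_mul.add_left matrix_mul.add_right
          matrix_mul.diff_left matrix_mul.diff_right f_def P_def Q_def MR cancel flip: matrix_mul_assoc)
    ultimately show ?thesis by simp
  qed
  note f = lyapunov_integral[OF K this]
  have FM: "F t = M ** f t ** M" for t
    by (simp add: f_def RM cancel flip: matrix_mul_assoc)
  have lin: "bounded_linear (\<lambda>Z. M ** Z ** M)"
    by (intro bounded_linear_compose[OF matrix_mul.bounded_linear_left] matrix_mul.bounded_linear_right)
  show "set_integrable lborel {0..} F"
    using integrable_bounded_linear[OF lin f(1)[unfolded set_integrable_def]]
    by (simp add: set_integrable_def FM matrix_mul.scaleR_left matrix_mul.scaleR_right)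
  define z where "z = (LBINT t:{0..}. f t)"
  have "(LBINT t:{0..}. F t) = M ** z ** M"
    using integral_bounded_linear[OF lin f(1)[unfolded set_integrable_def]]
    by (simp add: z_def set_lebesgue_integral_def FM matrix_mul.scaleR_left matrix_mul.scaleR_right)
  then have "P ** (LBINT t:{0..}. F t) + (LBINT t:{0..}. F t) ** Q = M ** (K ** z + z ** K) ** M"
    by (simp add: P_def Q_def matrix_mul.add_left matrix_mul.add_right cancel flip: matrix_mul_assoc)
  also have "\<dots> = F 0"
    using f(2) by (simp add: z_def FM)
  also have "\<dots> = C"
    by (simp add: F_def mat_exp_0)
  finally show "P ** (LBINT t:{0..}. F t) + (LBINT t:{0..}. F t) ** Q = C" .
qed

section \<open>Differentiating the geometric mean\<close>

lemma geom_mean_factors: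
  assumes A: "pos_def A" and B: "pos_def B"
  obtains M R K where "hermitian M" "hermitian R" "M ** R = mat 1" "R ** M = mat 1" "M ** M = A"
    "matrix_inv A = R ** R" "pos_def K" "K ** K = R ** B ** R" "geom_mean A B = M ** K ** M"
proof -
  define M where "M = pd_sqrt A"
  have M: "pos_def M" "M ** M = A" using pd_sqrt[OF A] by (simp_all add: M_def)
  obtain R where R: "M ** R = mat 1" "R ** M = mat 1" "matrix_inv M = R" "pos_def R"
    using pos_def_inverse[OF M(1)] by metis
  define K where "K = pd_sqrt (R ** B ** R)"
  have "pos_def (R ** B ** R)"
    using pos_def_congruence_hermitian[OF B pos_def_hermitian[OF R(4)] R(1)] .
  then have K: "pos_def K" "K ** K = R ** B ** R"
    using pd_sqrt by (simp_all add: K_def)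
  have "A ** (R ** R) = mat 1"
    using R(1) by (metis M(2) matrix_mul_assoc matrix_mul_rid)
  then have "matrix_inv A = R ** R"
    using pos_def_inverse[OF A] by (metis matrix_mul_assoc matrix_mul_lid matrix_mul_rid)
  moreover have "geom_mean A B = M ** K ** M"
    by (simp add: geom_mean_def R(3) K_def flip: M_def)
  ultimately show ?thesis
    using that M R K pos_def_hermitian by metis
qed

text \<open>The last two facts split \<open>G A^-1 G = B\<close> through \<open>Q = A^-1 G\<close>
  into \<open>A Q = G\<close> and \<open>G Q = B\<close>, in which no inverse has to be
  differentiated.\<close>

lemma geom_mean_pos_def:
  assumes A: "pos_def A" and B: "pos_def B"
  shows "pos_def (geom_mean A B)"
    and "A ** (matrix_inv A ** geom_mean A B) = geom_mean A B"
    and "geom_mean A B ** (matrix_inv A ** geom_mean A B) = B"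
proof -
  obtain M R K where *: "hermitian M" "hermitian R" "M ** R = mat 1" "R ** M = mat 1" "M ** M = A"
    "matrix_inv A = R ** R" "pos_def K" "K ** K = R ** B ** R" "geom_mean A B = M ** K ** M"
    using geom_mean_factors[OF A B] by metis
  have cancel: "M ** (R ** Z) = Z" "R ** (M ** Z) = Z" "K ** (K ** Z) = R ** (B ** (R ** Z))" for Z
    using *(3,4,8) by (simp_all add: matrix_mul_assoc)
  have square: "A ** V = M ** (M ** V)" for V
    by (simp add: *(5) matrix_mul_assoc)
  show "pos_def (geom_mean A B)"
    using pos_def_congruence_hermitian[OF *(7,1,4)] *(9) by simp
  show "A ** (matrix_inv A ** geom_mean A B) = geom_mean A B"
    unfolding square *(6,9) by (simp add: cancel flip: matrix_mul_assoc)
  show "geom_mean A B ** (matrix_inv A ** geom_mean A B) = B"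
    by (simp add: *(6,9) *(4) cancel flip: matrix_mul_assoc)
qed

text \<open>A single constant serves all small \<open>t\<close>; this is what makes the later
  estimates of increments uniform.\<close>

lemma pos_def_line_coercive:
  fixes A X :: "complex^'n^'n"
  assumes "pos_def A" "hermitian X"
  obtains c e where "0 < c" "0 < e" "\<And>t x. \<bar>t\<bar> < e \<Longrightarrow> c * (x \<bullet> x) \<le> x \<bullet> ((A + t *\<^sub>R X) *v x)"
    "\<And>t. \<bar>t\<bar> < e \<Longrightarrow> pos_def (A + t *\<^sub>R X)"
proof -
  obtain c where c: "0 < c" "\<And>x. c * (x \<bullet> x) \<le> x \<bullet> (A *v x)"
    using pos_def_coercive[OF assms(1)] by metis
  obtain k where k: "0 < k" "\<And>x. norm (X *v x) \<le> k * norm x"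
    using linear_bounded_pos[OF matrix_vector_mul_linear[of X]] by metis
  \<comment> \<open>For \<open>t\<close> below this bound the perturbation uses up at most half of
    \<open>c\<close>.\<close>
  define e where "e = c / (2 * k)"
  have coercive: "c / 2 * (x \<bullet> x) \<le> x \<bullet> ((A + t *\<^sub>R X) *v x)" if "\<bar>t\<bar> < e" for t x
  proof -
    have "\<bar>x \<bullet> (X *v x)\<bar> \<le> norm x * norm (X *v x)"
      by (rule Cauchy_Schwarz_ineq2)
    also have "\<dots> \<le> norm x * (k * norm x)"
      by (intro mult_left_mono k) auto
    finally have "\<bar>x \<bullet> (X *v x)\<bar> \<le> k * (x \<bullet> x)"
      by (simp add: dot_square_norm power2_eq_square algebra_simps)
    then have "\<bar>t\<bar> * \<bar>x \<bullet> (X *v x)\<bar> \<le> e * (k * (x \<bullet> x))"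
      using that by (intro mult_mono) auto
    also have "\<dots> = c / 2 * (x \<bullet> x)"
      using k(1) by (simp add: e_def)
    finally have "\<bar>t * (x \<bullet> (X *v x))\<bar> \<le> c / 2 * (x \<bullet> x)"
      by (simp add: abs_mult)
    then show ?thesis
      using c(2)[of x]
      by (simp add: matrix_vector_mult_add_rdistrib scaleR_matrix_vector inner_add_right abs_le_iff)
  qed
  show ?thesis
  proof (rule that[OF _ _ coercive])
    show "0 < c / 2" "0 < e" using c(1) k(1) by (simp_all add: e_def)
    show "pos_def (A + t *\<^sub>R X)" if "\<bar>t\<bar> < e" for t
      using pos_defI_coercive[OF _ \<open>0 < c / 2\<close> coercive[OF that]] assms
      by (simp add: hermitian_add hermitian_scaleR pos_def_hermitian)
  qed
qed

text \<open>Pairing with \<open>E\<close> works because both right factors are squares of Hermitian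
  matrices, \<open>R ** R\<close> and \<open>H = S ** S\<close>. Half of each moves to the other
  argument, leaving the quadratic forms of \<open>G\<close> at \<open>E ** R\<close> and of
  \<open>A\<close> at \<open>E ** S\<close>.\<close>

lemma sylvester_bound:
  fixes G A H R E :: "complex^'n^'n"
  assumes G: "pos_def G" and R: "hermitian R"
    and A: "\<And>x. a * (x \<bullet> x) \<le> x \<bullet> (A *v x)" "0 < a"
    and H: "pos_def H" "\<And>x. h * (x \<bullet> x) \<le> x \<bullet> (H *v x)"
  shows "a * h * norm E \<le> norm (G ** E ** R ** R + A ** E ** H)"
proof -
  let ?W = "G ** E ** R ** R + A ** E ** H"
  define S where "S = pd_sqrt H"
  have S: "hermitian S" "S ** S = H"
    using pd_sqrt[OF H(1)] by (simp_all add: S_def pos_def_hermitian)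
  have symmetric: "E \<bullet> (V ** E ** T ** T) = (E ** T) \<bullet> (V ** (E ** T))" if "hermitian T" for V T :: "complex^'n^'n"
    using that by (simp add: inner_mult_right hermitian_def matrix_mul_assoc)
  have "0 \<le> x \<bullet> (G *v x)" for x
    using G by (cases "x = 0") (auto simp: pos_def_iff less_imp_le)
  then have "0 \<le> E \<bullet> (G ** E ** R ** R)"
    unfolding symmetric[OF R] using inner_matrix_coercive[of 0 G "E ** R"] by simp
  moreover have "a * h * (E \<bullet> E) \<le> E \<bullet> (A ** E ** H)"
  proof -
    have "a * h * (E \<bullet> E) \<le> a * (E \<bullet> (E ** H))"
      using inner_matrix_coercive_right[OF pos_def_hermitian[OF H(1)] H(2), of E] A(2)
      by (simp add: mult_left_mono mult.assoc)
    also have "\<dots> = a * ((E ** S) \<bullet> (E ** S))"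
      using S symmetric[of S "mat 1"] by (simp flip: matrix_mul_assoc)
    also have "\<dots> \<le> (E ** S) \<bullet> (A ** (E ** S))"
      by (rule inner_matrix_coercive[OF A(1)])
    also have "\<dots> = E \<bullet> (A ** E ** H)"
      using symmetric[OF S(1), of A] S(2) by (simp flip: matrix_mul_assoc)
    finally show ?thesis .
  qed
  ultimately have "a * h * (E \<bullet> E) \<le> E \<bullet> ?W"
    by (simp add: inner_add_right)
  also have "\<dots> \<le> norm E * norm ?W" by (rule norm_cauchy_schwarz)
  finally have "norm E * (a * h * norm E) \<le> norm E * norm ?W"
    by (simp add: dot_square_norm power2_eq_square mult_ac)
  then show ?thesis
    by (cases "E = 0") auto
qed

text \<open>With \<open>Q = A\<^sup>-\<^sup>1 G\<close> the equation \<open>G A\<^sup>-\<^sup>1 G = B\<close> becomes \<open>A Q\<^sup>2 = B\<close>. Subtracting it at two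
  points of the line gives a Sylvester equation for the increment of \<open>Q\<close> whose right-hand side is
  known and whose solutions are bounded by coercivity; so \<open>Q\<close> is first seen to be Lipschitz
  and then differentiable.\<close>

lemma geom_mean_derivative:
  fixes A B X Y Z :: "complex^'n^'n"
  assumes A: "pos_def A" and B: "pos_def B" and X: "hermitian X" and Y: "hermitian Y"
  defines "P \<equiv> geom_mean A B ** matrix_inv A" and "Q \<equiv> matrix_inv A ** geom_mean A B"
  assumes Z: "P ** Z + Z ** Q = Y + P ** X ** Q"
  shows "((\<lambda>t. geom_mean (A + t *\<^sub>R X) (B + t *\<^sub>R Y)) has_vector_derivative Z) (at 0)"
proof -
  obtain M R K where *: "hermitian M" "hermitian R" "M ** R = mat 1" "R ** M = mat 1" "M ** M = A"
    "matrix_inv A = R ** R" "pos_def K" "K ** K = R ** B ** R" "geom_mean A B = M ** K ** M"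
    using geom_mean_factors[OF A B] by metis
  \<comment> \<open>\<open>Q\<close> is not Hermitian, but \<open>Q A^-1 = A^-1 G A^-1\<close> is;
    hence the factors \<open>R ** R\<close> on the right in the estimates below.\<close>
  define H where "H = R ** K ** R"
  have H: "pos_def H" "Q ** R ** R = H"
    using pos_def_congruence_hermitian[OF *(7,2,3)]
    by (simp_all add: H_def Q_def *(3,6,9) matrix_mul_assoc *(4))
      (metis *(3,4) matrix_mul_assoc matrix_mul_rid)
  obtain h where h: "0 < h" "\<And>x. h * (x \<bullet> x) \<le> x \<bullet> (H *v x)"
    using pos_def_coercive[OF H(1)] by metis
  obtain a e where a: "0 < a" "0 < e" "\<And>t x. \<bar>t\<bar> < e \<Longrightarrow> a * (x \<bullet> x) \<le> x \<bullet> ((A + t *\<^sub>R X) *v x)"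
    "\<And>t. \<bar>t\<bar> < e \<Longrightarrow> pos_def (A + t *\<^sub>R X)"
    using pos_def_line_coercive[OF A X] by metis
  obtain e' where e': "0 < e'" "\<And>t. \<bar>t\<bar> < e' \<Longrightarrow> pos_def (B + t *\<^sub>R Y)"
    using pos_def_line_coercive[OF B Y] by metis
  define d where "d = min e e'"
  have d: "0 < d" using a(2) e'(1) by (simp add: d_def)
  define G where "G t = geom_mean (A + t *\<^sub>R X) (B + t *\<^sub>R Y)" for t
  define q where "q t = matrix_inv (A + t *\<^sub>R X) ** G t" for t
  have G: "pos_def (G t)" "(A + t *\<^sub>R X) ** q t = G t" "G t ** q t = B + t *\<^sub>R Y" if "\<bar>t\<bar> < d" for t
    unfolding q_def G_def
    using geom_mean_pos_def[OF a(4) e'(2), of t t] that by (simp_all add: d_def)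
  have q0: "q 0 = Q" by (simp add: q_def Q_def G_def)
  have AQ: "A ** Q = G 0" "G 0 ** Q = B"
    using G(2,3)[of 0] d q0 by auto
  \<comment> \<open>The constant is independent of \<open>t\<close>: \<open>a\<close> is uniform,
    \<open>H\<close> comes from the fixed \<open>Q\<close>, and \<open>G t\<close> enters only
    through its positivity.\<close>
  have bound: "norm V \<le> norm ((G t ** V + (A + t *\<^sub>R X) ** V ** Q) ** R ** R) / (a * h)"
    if "\<bar>t\<bar> < d" for t V
    using sylvester_bound[OF G(1)[OF that] *(2) a(3) a(1) H(1) h(2), of t V] that a(1) h(1)
    by (simp add: d_def field_simps matrix_mul.add_left flip: H(2) matrix_mul_assoc)
  have increment: "G t ** (q t - Q) + (A + t *\<^sub>R X) ** (q t - Q) ** Q = t *\<^sub>R (Y - X ** Q ** Q)"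
    if "\<bar>t\<bar> < d" for t
    using G(2,3)[OF that] AQ
    by (simp add: matrix_mul.diff_left matrix_mul.diff_right matrix_mul.add_left scaleR_diff_right
        matrix_mul.scaleR_left)
  define C where "C = norm ((Y - X ** Q ** Q) ** R ** R) / (a * h)"
  have lipschitz: "norm (q t - Q) \<le> \<bar>t\<bar> * C" if "\<bar>t\<bar> < d" for t
    using bound[OF that, of "q t - Q"] unfolding increment[OF that]
    by (simp add: C_def matrix_mul.scaleR_left)
  have near: "\<forall>\<^sub>F t in at 0. \<bar>t\<bar> < d"
    using d by (auto simp: eventually_at dist_real_def)
  have "((\<lambda>t. q t - Q) \<longlongrightarrow> 0) (at 0)"
  proof (rule Lim_null_comparison)
    show "\<forall>\<^sub>F t in at 0. norm (q t - Q) \<le> \<bar>t\<bar> * C"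
      using near lipschitz by (rule eventually_mono)
    show "((\<lambda>t::real. \<bar>t\<bar> * C) \<longlongrightarrow> 0) (at 0)"
      by (rule tendsto_eq_intros refl | simp)+
  qed
  then have "(q \<longlongrightarrow> Q) (at 0)" by (simp add: LIM_zero_cancel)
  then have "((\<lambda>t. (A + t *\<^sub>R X) ** q t) \<longlongrightarrow> (A + 0 *\<^sub>R X) ** Q) (at 0)"
    by (intro matrix_mul.tendsto tendsto_intros)
  then have limG: "(G \<longlongrightarrow> G 0) (at 0)"
    using near G(2) AQ(1) by (auto elim!: Lim_transform_eventually eventually_mono)
  \<comment> \<open>The candidate for the derivative of \<open>q\<close> at 0, obtained by
    differentiating \<open>A Q = G\<close> to \<open>X Q + A E = Z\<close>.\<close>
  define E where "E = R ** R ** (Z - X ** Q)"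
  have AE: "A ** E = Z - X ** Q"
    unfolding E_def *(5)[symmetric] by (metis *(3) matrix_mul_assoc matrix_mul_lid)
  have "G 0 ** E = P ** (Z - X ** Q)"
    by (simp add: E_def P_def *(6) G_def matrix_mul_assoc)
  then have "G 0 ** E + A ** E ** Q = (P ** Z + Z ** Q) - P ** X ** Q - X ** Q ** Q"
    by (simp add: AE matrix_mul.diff_left matrix_mul.diff_right matrix_mul_assoc)
  then have E: "G 0 ** E + A ** E ** Q = Y - X ** Q ** Q"
    unfolding Z by simp
  \<comment> \<open>The remainder \<open>q t - Q - t *\<^sub>R E\<close> solves the same Sylvester
    equation with right-hand side
    \<open>t *\<^sub>R ((G 0 - G t) ** E - t *\<^sub>R (X ** E ** Q))\<close>. After division by
    \<open>t\<close> this tends to 0 by continuity of \<open>G\<close> at 0, which is why the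
    Lipschitz bound comes first.\<close>
  define N where "N t = norm (((G 0 - G t) ** E - t *\<^sub>R (X ** E ** Q)) ** R ** R) / (a * h)" for t
  have q': "(q has_vector_derivative E) (at 0)"
    unfolding has_vector_derivative_def
  proof (rule has_derivativeI_sandwich[OF d bounded_linear_scaleR_left])
    fix t :: real assume t: "t \<noteq> 0" "dist t 0 < d"
    let ?V = "q t - Q - t *\<^sub>R E"
    have td: "\<bar>t\<bar> < d" using t(2) by simp
    have "G t ** ?V + (A + t *\<^sub>R X) ** ?V ** Q
        = t *\<^sub>R (Y - X ** Q ** Q) - t *\<^sub>R (G t ** E + (A + t *\<^sub>R X) ** E ** Q)"
      unfolding increment[OF td, symmetric]
      by (simp add: matrix_mul.diff_left matrix_mul.diff_right matrix_mul.scaleR_left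
          matrix_mul.scaleR_right scaleR_add_right)
    also have "\<dots> = t *\<^sub>R ((G 0 - G t) ** E - t *\<^sub>R (X ** E ** Q))"
      unfolding E[symmetric]
      by (simp add: matrix_mul.diff_left matrix_mul.add_left matrix_mul.scaleR_left algebra_simps)
    finally have "norm ?V \<le> \<bar>t\<bar> * N t"
      using bound[OF td, of ?V] by (simp add: N_def matrix_mul.scaleR_left)
    then show "norm (q t - q 0 - (t - 0) *\<^sub>R E) / norm (t - 0) \<le> N t"
      using t(1) by (simp add: q0 field_simps)
  next
    have "(N \<longlongrightarrow> norm (((G 0 - G 0) ** E - 0 *\<^sub>R (X ** E ** Q)) ** R ** R) / (a * h)) (at 0)"
      unfolding N_def using a(1) h(1)
      by (intro tendsto_intros matrix_mul.tendsto limG) auto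
    then show "(N \<longlongrightarrow> 0) (at 0)" by simp
  qed
  have "((\<lambda>t. A + t *\<^sub>R X) has_vector_derivative X) (at 0)"
    unfolding has_vector_derivative_def by (rule derivative_eq_intros refl | simp)+
  from matrix_mul.has_vector_derivative[OF this q']
  have "((\<lambda>t. (A + t *\<^sub>R X) ** q t) has_vector_derivative Z) (at 0)"
    by (simp add: q0 AE)
  then have "(G has_vector_derivative Z) (at 0)"
    by (rule has_vector_derivative_transform_within_open[where S = "{-d<..<d}"]) (use d G(2) in auto)
  moreover have "G = (\<lambda>t. geom_mean (A + t *\<^sub>R X) (B + t *\<^sub>R Y))"
    by (simp add: fun_eq_iff G_def)
  ultimately show ?thesis by simp
qed

theorem proposition2p1:
  fixes A B X Y :: "complex^'n^'n"
  assumes "pos_def A" and "pos_def B" and "hermitian X" and "hermitian Y"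
  shows "set_integrable lborel {0..} (geom_mean_integrand A B X Y)
    \<and> ((\<lambda>t::real. geom_mean (A + t *\<^sub>R X) (B + t *\<^sub>R Y)) has_vector_derivative
         (LBINT t:{0..}. geom_mean_integrand A B X Y t)) (at 0)"
proof -
  obtain M R K where *: "hermitian M" "hermitian R" "M ** R = mat 1" "R ** M = mat 1" "M ** M = A"
    "matrix_inv A = R ** R" "pos_def K" "K ** K = R ** B ** R" "geom_mean A B = M ** K ** M"
    using geom_mean_factors[OF assms(1,2)] by metis
  define P where "P = M ** K ** R"
  define Q where "Q = R ** K ** M"
  have cancel: "M ** (R ** V) = V" "R ** (M ** V) = V" "K ** (K ** V) = R ** (B ** (R ** V))" for V
    using *(3,4,8) by (simp_all add: matrix_mul_assoc)
  \<comment> \<open>Here \<open>B ** R ** R = M ** K ** K ** R\<close>, and for \<open>Q\<close> the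
    same argument applies with \<open>M\<close> and \<open>R\<close> exchanged.\<close>
  have P: "pe_sqrt (B ** matrix_inv A) = P"
    using pe_sqrt_similar[OF *(7,4)] by (simp add: P_def *(6) cancel flip: matrix_mul_assoc)
  have Q: "pe_sqrt (matrix_inv A ** B) = Q"
    using pe_sqrt_similar[OF *(7,3)] by (simp add: Q_def *(6) *(4) cancel flip: matrix_mul_assoc)
  define F where "F t = mat_exp ((- t) *\<^sub>R P) ** (Y + P ** X ** Q) ** mat_exp ((- t) *\<^sub>R Q)" for t
  have F: "geom_mean_integrand A B X Y = F"
    by (simp add: fun_eq_iff geom_mean_integrand_def F_def P Q)
  note sylvester = sylvester_integral[OF *(7,3), of "Y + P ** X ** Q", folded P_def Q_def, folded F_def]
  have "geom_mean A B ** matrix_inv A = P" "matrix_inv A ** geom_mean A B = Q"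
    by (simp_all add: P_def Q_def *(6,9) *(3) cancel flip: matrix_mul_assoc)
  then show ?thesis
    using sylvester geom_mean_derivative[OF assms] by (simp add: F)
qed

end
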